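(* Let $q\in\mathbb{C}$ be nonzero and not a root of unity, and let $x\in\mathbb{C}$. For all $u,v,w\in\mathbb{C}$, the operators $\check R^{\Box}$ defined in the context satisfy the (twisted) Yang–Baxter equation $$(\check R^{\Box}(v,w;x)\otimes I)(I\otimes \check R^{\Box}(u,w;qx))(\check R^{\Box}(u,v;x)\otimes I)=(I\otimes \check R^{\Box}(u,v;qx))(\check R^{\Box}(u,w;x)\otimes I)(I\otimes \check R^{\Box}(v,w;qx))$$ as an identity of endomorphisms of $\mathbb{C}^4\otimes\mathbb{C}^4\otimes\mathbb{C}^4$.
   Context: Throughout, $q\in\mathbb{C}$, $q\neq 0$, and $q^r\neq 1$ for every positive integer $r$. Tensor products are ordinary (not $\mathbb{Z}_2$-graded) tensor products over $\mathbb{C}$, and $I$ is the identity of $\mathbb{C}^4$. Let $e_1,e_2,e_3,e_4$ be the standard basis of $\mathbb{C}^4$. Put $\theta(1)=\theta(2)=0$ and $\theta(3)=\theta(4)=1$. For $x\in\mathbb{C}$ write $V_x=\mathbb{C}^4$ (the same vector space for every $x$). Define subspaces of $V_x\otimes V_{qx}=\mathbb{C}^4\otimes\mathbb{C}^4$ by $$V_x^{(1)}=\mathbb{C}(e_3\otimes e_3)\oplus\mathbb{C}(e_4\otimes e_4)\oplus\bigoplus_{1\le i<j\le 4}\mathbb{C}\bigl(e_i\otimes e_j-(-1)^{\theta(i)\theta(j)}q\,e_j\otimes e_i+\delta_{i1}\delta_{j2}(q^3x\,e_3\otimes e_4+x\,e_4\otimes e_3)\bigr),$$ $$V_x^{(2)}=\mathbb{C}(e_1\otimes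 e_1)\oplus\mathbb{C}(e_2\otimes e_2)\oplus\bigoplus_{1\le i<j\le 4}\mathbb{C}\bigl(e_i\otimes e_j+(-1)^{\theta(i)\theta(j)}q^{-1}e_j\otimes e_i\bigr).$$ One has $\mathbb{C}^4\otimes\mathbb{C}^4=V_x^{(1)}\oplus V_x^{(2)}$. Let $P_x^{(i)}\in\mathrm{End}(\mathbb{C}^4\otimes\mathbb{C}^4)$ ($i=1,2$) be the corresponding projections: $P_x^{(i)}(v)=\delta_{ij}v$ for $v\in V_x^{(j)}$. For $u,v,x\in\mathbb{C}$ define $$\check R^{\Box}(u,v;x)=(q^2u-v)P_x^{(1)}+(q^2v-u)P_x^{(2)}\in\mathrm{End}(\mathbb{C}^4\otimes\mathbb{C}^4).$$ *)

theory Defs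
  imports "HOL-Analysis.Analysis"
begin

text \<open>
  The tensor product of the coordinate spaces \<open>complex^'a\<close> and \<open>complex^'b\<close> is realised
  as \<open>complex^('a \<times> 'b)\<close>; its complex-linear structure is the one given by \<open>(*s)\<close>
  (with \<open>vec.span\<close> and \<open>Vector_Spaces.linear\<close>), not the real one given by \<open>(*\<^sub>R)\<close>.
  Endomorphisms are complex-linear functions, and products of endomorphisms are compositions.
\<close>

definition tensor :: "complex^'a \<Rightarrow> complex^'b \<Rightarrow> complex^('a::finite \<times> 'b::finite)"
    (infixr "\<otimes>" 75) where
  "a \<otimes> b = (\<chi> p. a $ fst p * b $ snd p)"

text \<open>The linear extension of \<open>a \<otimes> b \<mapsto> f a \<otimes> g b\<close> from basis vectors.\<close>

definition tensor_map ::
    "(complex^'a \<Rightarrow> complex^'c) \<Rightarrow> (complex^'b \<Rightarrow> complex^'d) \<Rightarrow>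
     complex^('a::finite \<times> 'b::finite) \<Rightarrow> complex^('c::finite \<times> 'd::finite)"
    (infixr "\<otimes>\<^sub>m" 75) where
  "f \<otimes>\<^sub>m g = (\<lambda>t. \<Sum>p\<in>UNIV. t $ p *s (f (axis (fst p) 1) \<otimes> g (axis (snd p) 1)))"

text \<open>The canonical associativity isomorphism and its inverse.\<close>

definition assoc_r ::
    "complex^(('a::finite \<times> 'b::finite) \<times> 'c::finite) \<Rightarrow> complex^('a \<times> 'b \<times> 'c)" where
  "assoc_r t = (\<chi> p. t $ ((fst p, fst (snd p)), snd (snd p)))"

definition assoc_l ::
    "complex^('a::finite \<times> 'b::finite \<times> 'c::finite) \<Rightarrow> complex^(('a \<times> 'b) \<times> 'c)" where
  "assoc_l t = (\<chi> p. t $ (fst (fst p), snd (fst p), snd p))"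

text \<open>
  Basis indices are natural numbers, because the order of the numeral type \<open>4\<close>
  identifies the index 4 with 0 and so makes it the least one.
\<close>

definition e :: "nat \<Rightarrow> complex^4" where
  "e i = axis (of_nat i) 1"

definition \<theta> :: "nat \<Rightarrow> nat" where
  "\<theta> i = (if i \<in> {3, 4} then 1 else 0)"

definition V1 :: "complex \<Rightarrow> complex \<Rightarrow> (complex^(4 \<times> 4)) set" where
  "V1 q x = vec.span
     ({e 3 \<otimes> e 3, e 4 \<otimes> e 4} \<union>
      {e i \<otimes> e j - ((-1) ^ (\<theta> i * \<theta> j) * q) *s (e j \<otimes> e i)
         + (if i = 1 \<and> j = 2
            then (q ^ 3 * x) *s (e 3 \<otimes> e 4) + x *s (e 4 \<otimes> e 3) else 0)
       | i j. 1 \<le> i \<and> i < j \<and> j \<le> 4})"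

definition V2 :: "complex \<Rightarrow> (complex^(4 \<times> 4)) set" where
  "V2 q = vec.span
     ({e 1 \<otimes> e 1, e 2 \<otimes> e 2} \<union>
      {e i \<otimes> e j + ((-1) ^ (\<theta> i * \<theta> j) * inverse q) *s (e j \<otimes> e i)
       | i j. 1 \<le> i \<and> i < j \<and> j \<le> 4})"

text \<open>Meaningful only if \<open>U\<close> and \<open>W\<close> are complementary subspaces.\<close>

definition projection ::
    "(complex^'n) set \<Rightarrow> (complex^'n) set \<Rightarrow> complex^'n \<Rightarrow> complex^'n::finite" where
  "projection U W = (THE P. Vector_Spaces.linear (*s) (*s) P \<and>
     (\<forall>v\<in>U. P v = v) \<and> (\<forall>v\<in>W. P v = 0))"

definition P1 :: "complex \<Rightarrow> complex \<Rightarrow> complex^(4 \<times> 4) \<Rightarrow> complex^(4 \<times> 4)" where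
  "P1 q x = projection (V1 q x) (V2 q)"

definition P2 :: "complex \<Rightarrow> complex \<Rightarrow> complex^(4 \<times> 4) \<Rightarrow> complex^(4 \<times> 4)" where
  "P2 q x = projection (V2 q) (V1 q x)"

definition R_box ::
    "complex \<Rightarrow> complex \<Rightarrow> complex \<Rightarrow> complex \<Rightarrow> complex^(4 \<times> 4) \<Rightarrow> complex^(4 \<times> 4)" where
  "R_box q u v x = (\<lambda>t. (q\<^sup>2 * u - v) *s P1 q x t + (q\<^sup>2 * v - u) *s P2 q x t)"

text \<open>\<open>A \<otimes> I\<close> and \<open>I \<otimes> A\<close> as endomorphisms of the same triple tensor product.\<close>

definition on_12 ::
    "(complex^(4 \<times> 4) \<Rightarrow> complex^(4 \<times> 4)) \<Rightarrow> complex^(4 \<times> 4 \<times> 4) \<Rightarrow> complex^(4 \<times> 4 \<times> 4)" where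
  "on_12 A = assoc_r \<circ> (A \<otimes>\<^sub>m (id :: complex^4 \<Rightarrow> complex^4)) \<circ> assoc_l"

definition on_23 ::
    "(complex^(4 \<times> 4) \<Rightarrow> complex^(4 \<times> 4)) \<Rightarrow> complex^(4 \<times> 4 \<times> 4) \<Rightarrow> complex^(4 \<times> 4 \<times> 4)" where
  "on_23 A = (id :: complex^4 \<Rightarrow> complex^4) \<otimes>\<^sub>m A"

lemma assoc_r_tensor: "assoc_r ((a \<otimes> b) \<otimes> c) = a \<otimes> b \<otimes> c"
  by (simp add: assoc_r_def tensor_def vec_eq_iff mult.assoc)

lemma assoc_l_tensor: "assoc_l (a \<otimes> b \<otimes> c) = (a \<otimes> b) \<otimes> c"
  by (simp add: assoc_l_def tensor_def vec_eq_iff mult.assoc)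

lemma tensor_map_tensor:
  assumes "Vector_Spaces.linear (*s) (*s) f" and "Vector_Spaces.linear (*s) (*s) g"
  shows "(f \<otimes>\<^sub>m g) (a \<otimes> b) = f a \<otimes> g b"
proof -
  have expand: "h c $ k = (\<Sum>i\<in>UNIV. c $ i * h (axis i 1) $ k)"
    if "Vector_Spaces.linear (*s) (*s) h"
    for h :: "complex^'m::finite \<Rightarrow> complex^'n::finite" and c k
  proof -
    interpret h: Vector_Spaces.linear "(*s)" "(*s)" h by (fact that)
    have "h c = h (\<Sum>i\<in>UNIV. c $ i *s axis i 1)"
      by (simp add: basis_expansion)
    also have "\<dots> = (\<Sum>i\<in>UNIV. c $ i *s h (axis i 1))"
      by (simp add: h.sum h.scale)
    finally show ?thesis by simp
  qed
  show ?thesis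
    by (simp add: vec_eq_iff tensor_map_def tensor_def
        expand[OF assms(1), of a] expand[OF assms(2), of b] sum_product
        sum.cartesian_product UNIV_Times_UNIV[symmetric] case_prod_beta mult_ac
        del: UNIV_Times_UNIV)
qed

end

theory Submission
  imports Defs
begin

text \<open>
  Put \<open>S\<^sub>x = (1 + q\<^sup>2) P\<^sub>x\<^sup>(\<^sup>1\<^sup>)\<close>; the factor is nonzero because \<open>q\<^sup>4 \<noteq> 1\<close>. Since the two
  projections add up to the identity, the R-matrix is
  \<open>R(u,v;x) = (q\<^sup>2 v - u) + (u - v) S\<^sub>x\<close> (lemma \<open>R_box_eq_hecke\<close>), and \<open>S\<^sub>x\<close> satisfies
  \<open>S\<^sub>x S\<^sub>x = (1 + q\<^sup>2) S\<^sub>x\<close>. Moreover \<open>S\<^sub>x\<close> has a simple closed form, polynomial in \<open>q\<close> and \<open>x\<close>: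
  it is the operator \<open>hecke q x\<close>. For \<open>x = 0\<close> this is the identity plus the Hecke generator
  that deforms the graded flip up to sign, and \<open>x\<close> only adds a term that sends \<open>e\<^sub>1 \<otimes> e\<^sub>2\<close> and \<open>e\<^sub>2 \<otimes> e\<^sub>1\<close> to the span of
  \<open>e\<^sub>3 \<otimes> e\<^sub>4\<close> and \<open>e\<^sub>4 \<otimes> e\<^sub>3\<close>.

  Let \<open>A = S\<^sub>x \<otimes> I\<close> and \<open>B = I \<otimes> S\<^sub>q\<^sub>x\<close>. Comparing the 64 coordinates gives the
  cubic relation \<open>A B A - q\<^sup>2 A = B A B - q\<^sup>2 B\<close> (lemma \<open>hecke_braid\<close>); the twist of the parameter
  from \<open>x\<close> to \<open>q x\<close> is what makes it hold. Together with the two quadratic relations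
  it says that \<open>A - 1\<close> and \<open>B - 1\<close> satisfy the relations of the Hecke algebra of type \<open>A\<^sub>2\<close>.
  For such a pair the Yang-Baxter equation is the usual Baxterization
  identity (lemma \<open>baxterization\<close>), valid in any algebra.
\<close>

section \<open>Coordinates of operators on tensor products\<close>

lemma vec_eq_four_pairs:
  "s = t \<longleftrightarrow> (\<forall>i j. s $ (i :: 4, j :: 4) = t $ (i, j))"
  by (auto simp: vec_eq_iff)

lemma vec_eq_four_triples:
  "s = t \<longleftrightarrow> (\<forall>i j k. s $ (i :: 4, j :: 4, k :: 4) = t $ (i, j, k))"
  by (auto simp: vec_eq_iff)

lemma linear_cart:
  fixes f :: "complex^'m \<Rightarrow> complex^'n"
  assumes "\<And>s t. f (s + t) = f s + f t" and "\<And>c t. f (c *s t) = c *s f t"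
  shows "Vector_Spaces.linear (*s) (*s) f"
  by (metis assms Vector_Spaces.linear_iff vec.vector_space_axioms)

lemma linear_nth:
  assumes "Vector_Spaces.linear (*s) (*s) f"
  shows "f c $ k = (\<Sum>i\<in>UNIV. c $ i * f (axis i 1) $ k)"
proof -
  interpret f: Vector_Spaces.linear "(*s)" "(*s)" f by (fact assms)
  have "f c = f (\<Sum>i\<in>UNIV. c $ i *s axis i 1)"
    by (simp add: basis_expansion)
  also have "\<dots> = (\<Sum>i\<in>UNIV. c $ i *s f (axis i 1))"
    by (simp add: f.sum f.scale)
  finally show ?thesis by simp
qed

lemma sum_axis: "(\<Sum>i\<in>UNIV. f i * axis i (1::complex) $ k) = f k"
  by (simp add: axis_def if_distrib sum.delta cong: if_cong)

text \<open>
  A linear operator on two of the three factors acts on each slice of the tensor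
  that is obtained by fixing the index of the remaining factor.
\<close>

lemma on_12_nth:
  assumes "Vector_Spaces.linear (*s) (*s) A"
  shows "on_12 A t $ (i, j, k) = A (\<chi> p. t $ (fst p, snd p, k)) $ (i, j)"
proof -
  have "on_12 A t $ (i, j, k)
      = (\<Sum>p\<in>UNIV. \<Sum>m\<in>UNIV. t $ (fst p, snd p, m) * A (axis p 1) $ (i, j) * axis m 1 $ k)"
    by (simp add: on_12_def assoc_r_def assoc_l_def tensor_map_def tensor_def
        sum.cartesian_product UNIV_Times_UNIV[symmetric] case_prod_beta mult.assoc
        del: UNIV_Times_UNIV)
  then show ?thesis
    by (simp add: linear_nth[OF assms, of "\<chi> p. _ p"] sum_axis)
qed

lemma on_23_nth:
  assumes "Vector_Spaces.linear (*s) (*s) A"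
  shows "on_23 A t $ (i, j, k) = A (\<chi> p. t $ (i, p)) $ (j, k)"
proof -
  have "on_23 A t $ (i, j, k)
      = (\<Sum>m\<in>UNIV. \<Sum>p\<in>UNIV. t $ (m, p) * A (axis p 1) $ (j, k) * axis m 1 $ i)"
    by (simp add: on_23_def tensor_map_def tensor_def
        sum.cartesian_product UNIV_Times_UNIV[symmetric] case_prod_beta mult_ac
        del: UNIV_Times_UNIV)
  also have "\<dots> = (\<Sum>m\<in>UNIV. (\<Sum>p\<in>UNIV. t $ (m, p) * A (axis p 1) $ (j, k)) * axis m 1 $ i)"
    by (simp add: sum_distrib_right)
  finally show ?thesis
    by (simp add: linear_nth[OF assms, of "\<chi> p. _ p"] sum_axis)
qed

lemma on_23_slice:
  assumes "Vector_Spaces.linear (*s) (*s) A"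
  shows "(\<chi> p. on_23 A t $ (i, p)) = A (\<chi> p. t $ (i, p))"
  by (simp add: vec_eq_iff on_23_nth[OF assms])

lemma linear_on_12:
  assumes "Vector_Spaces.linear (*s) (*s) A"
  shows "Vector_Spaces.linear (*s) (*s) (on_12 A)"
  by (rule linear_cart) (simp_all add: vec_eq_iff on_12_nth assms linear_nth[OF assms, of "\<chi> p. _ p"]
      algebra_simps sum.distrib sum_distrib_left)

lemma linear_on_23:
  assumes "Vector_Spaces.linear (*s) (*s) A"
  shows "Vector_Spaces.linear (*s) (*s) (on_23 A)"
  by (rule linear_cart) (simp_all add: vec_eq_iff on_23_nth assms linear_nth[OF assms, of "\<chi> p. _ p"]
      algebra_simps sum.distrib sum_distrib_left)

section \<open>The rescaled projection in closed form\<close>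

text \<open>
  The strict order \<open>1 < 2 < 3 < 4\<close> on the indices. The order of the numeral type \<open>4\<close> cannot be used,
  as \<open>4 = 0\<close> is its least element.
\<close>

definition below :: "4 \<Rightarrow> 4 \<Rightarrow> bool" where
  "below i j \<longleftrightarrow> (i, j) \<in> {(1, 2), (1, 3), (1, 4), (2, 3), (2, 4), (3, 4)}"

text \<open>The indices \<open>i\<close> with \<open>\<theta>(i) = 1\<close>.\<close>

definition odd_index :: "4 \<Rightarrow> bool" where
  "odd_index i \<longleftrightarrow> i \<in> {3, 4}"

text \<open>
  The operator that turns out to be \<open>(1 + q\<^sup>2) P\<^sub>x\<^sup>(\<^sup>1\<^sup>)\<close>, given by its coordinates. With
  \<open>s = (-1)^(\<theta>(i) \<theta>(j))\<close>, the first summand is the operator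
  \<open>e\<^sub>i \<otimes> e\<^sub>j \<mapsto> e\<^sub>i \<otimes> e\<^sub>j - s q e\<^sub>j \<otimes> e\<^sub>i\<close>,
  \<open>e\<^sub>j \<otimes> e\<^sub>i \<mapsto> q\<^sup>2 e\<^sub>j \<otimes> e\<^sub>i - s q e\<^sub>i \<otimes> e\<^sub>j\<close> for \<open>i < j\<close>,
  and \<open>e\<^sub>i \<otimes> e\<^sub>i \<mapsto> (1 + q\<^sup>2) \<theta>(i) e\<^sub>i \<otimes> e\<^sub>i\<close>. The second summand sends
  \<open>e\<^sub>1 \<otimes> e\<^sub>2\<close> to \<open>x (q\<^sup>2 - 1) (q e\<^sub>3 \<otimes> e\<^sub>4 - e\<^sub>4 \<otimes> e\<^sub>3)\<close>, sends \<open>e\<^sub>2 \<otimes> e\<^sub>1\<close> to \<open>-q\<close> times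
  that vector, and kills the other basis vectors.
\<close>

definition hecke :: "complex \<Rightarrow> complex \<Rightarrow> complex^(4 \<times> 4) \<Rightarrow> complex^(4 \<times> 4)" where
  "hecke q x t = vec_lambda (\<lambda>(i, j).
     (if i = j then (if odd_index i then (1 + q\<^sup>2) * t $ (i, i) else 0)
      else (if below i j then 1 else q\<^sup>2) * t $ (i, j)
        - (if odd_index i \<and> odd_index j then - q else q) * t $ (j, i))
     + (if (i, j) = (3, 4) then x * (q ^ 3 - q) * (t $ (1, 2) - q * t $ (2, 1))
        else if (i, j) = (4, 3) then x * (1 - q\<^sup>2) * (t $ (1, 2) - q * t $ (2, 1))
        else 0))"

lemma hecke_nth:
  "hecke q x t $ (1, 1) = 0"
  "hecke q x t $ (2, 2) = 0"
  "hecke q x t $ (3, 3) = (1 + q\<^sup>2) * t $ (3, 3)"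
  "hecke q x t $ (4, 4) = (1 + q\<^sup>2) * t $ (4, 4)"
  "hecke q x t $ (1, 2) = t $ (1, 2) - q * t $ (2, 1)"
  "hecke q x t $ (2, 1) = q\<^sup>2 * t $ (2, 1) - q * t $ (1, 2)"
  "hecke q x t $ (1, 3) = t $ (1, 3) - q * t $ (3, 1)"
  "hecke q x t $ (3, 1) = q\<^sup>2 * t $ (3, 1) - q * t $ (1, 3)"
  "hecke q x t $ (1, 4) = t $ (1, 4) - q * t $ (4, 1)"
  "hecke q x t $ (4, 1) = q\<^sup>2 * t $ (4, 1) - q * t $ (1, 4)"
  "hecke q x t $ (2, 3) = t $ (2, 3) - q * t $ (3, 2)"
  "hecke q x t $ (3, 2) = q\<^sup>2 * t $ (3, 2) - q * t $ (2, 3)"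
  "hecke q x t $ (2, 4) = t $ (2, 4) - q * t $ (4, 2)"
  "hecke q x t $ (4, 2) = q\<^sup>2 * t $ (4, 2) - q * t $ (2, 4)"
  "hecke q x t $ (3, 4) = t $ (3, 4) + q * t $ (4, 3)
     + x * (q ^ 3 - q) * (t $ (1, 2) - q * t $ (2, 1))"
  "hecke q x t $ (4, 3) = q\<^sup>2 * t $ (4, 3) + q * t $ (3, 4)
     + x * (1 - q\<^sup>2) * (t $ (1, 2) - q * t $ (2, 1))"
  by (simp_all add: hecke_def below_def odd_index_def)

lemma linear_hecke: "Vector_Spaces.linear (*s) (*s) (hecke q x)"
  by (rule linear_cart; simp add: vec_eq_four_pairs forall_4 hecke_nth algebra_simps)

lemma hecke_hecke: "hecke q x (hecke q x t) = (1 + q\<^sup>2) *s hecke q x t"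
  by (simp add: vec_eq_four_pairs forall_4 hecke_nth algebra_simps power2_eq_square power3_eq_cube)

section \<open>Identification of the projections\<close>

text \<open>The generators of the first subspace that are indexed by pairs \<open>i < j\<close>.\<close>

definition gen1 :: "complex \<Rightarrow> complex \<Rightarrow> nat \<Rightarrow> nat \<Rightarrow> complex^(4 \<times> 4)" where
  "gen1 q x i j = e i \<otimes> e j - ((-1) ^ (\<theta> i * \<theta> j) * q) *s (e j \<otimes> e i)
     + (if i = 1 \<and> j = 2 then (q ^ 3 * x) *s (e 3 \<otimes> e 4) + x *s (e 4 \<otimes> e 3) else 0)"

text \<open>The generators of the second subspace that are indexed by pairs \<open>i < j\<close>.\<close>

definition gen2 :: "complex \<Rightarrow> nat \<Rightarrow> nat \<Rightarrow> complex^(4 \<times> 4)" where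
  "gen2 q i j = e i \<otimes> e j + ((-1) ^ (\<theta> i * \<theta> j) * inverse q) *s (e j \<otimes> e i)"

lemma index_pairs:
  "{f i j | i j. 1 \<le> i \<and> i < j \<and> j \<le> (4 :: nat)} = {f 1 2, f 1 3, f 1 4, f 2 3, f 2 4, f 3 4}"
proof -
  have "{(i, j). 1 \<le> i \<and> i < j \<and> j \<le> (4 :: nat)} = {(1, 2), (1, 3), (1, 4), (2, 3), (2, 4), (3, 4)}"
    by auto
  then have "case_prod f ` {(i, j). 1 \<le> i \<and> i < j \<and> j \<le> (4 :: nat)} = {f 1 2, f 1 3, f 1 4, f 2 3, f 2 4, f 3 4}"
    by simp
  moreover have "{f i j | i j. 1 \<le> i \<and> i < j \<and> j \<le> (4 :: nat)} = case_prod f ` {(i, j). 1 \<le> i \<and> i < j \<and> j \<le> (4 :: nat)}"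
    by auto
  ultimately show ?thesis by simp
qed

lemma V1_eq:
  "V1 q x = vec.span {e 3 \<otimes> e 3, e 4 \<otimes> e 4, gen1 q x 1 2, gen1 q x 1 3, gen1 q x 1 4,
     gen1 q x 2 3, gen1 q x 2 4, gen1 q x 3 4}"
  unfolding V1_def gen1_def[symmetric] index_pairs by (simp add: insert_commute)

lemma V2_eq:
  "V2 q = vec.span {e 1 \<otimes> e 1, e 2 \<otimes> e 2, gen2 q 1 2, gen2 q 1 3, gen2 q 1 4,
     gen2 q 2 3, gen2 q 2 4, gen2 q 3 4}"
  unfolding V2_def gen2_def[symmetric] index_pairs by (simp add: insert_commute)

lemma e_tensor_nth: "(e i \<otimes> e j) $ (k, l) = (if k = of_nat i \<and> l = of_nat j then 1 else 0)"
  by (simp add: tensor_def e_def axis_def)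

lemmas coordinates = vec_eq_four_pairs forall_4 hecke_nth gen1_def gen2_def e_tensor_nth \<theta>_def

lemma hecke_gen1:
  "hecke q x (e 3 \<otimes> e 3) = (1 + q\<^sup>2) *s (e 3 \<otimes> e 3)"
  "hecke q x (e 4 \<otimes> e 4) = (1 + q\<^sup>2) *s (e 4 \<otimes> e 4)"
  "hecke q x (gen1 q x 1 2) = (1 + q\<^sup>2) *s gen1 q x 1 2"
  "hecke q x (gen1 q x 1 3) = (1 + q\<^sup>2) *s gen1 q x 1 3"
  "hecke q x (gen1 q x 1 4) = (1 + q\<^sup>2) *s gen1 q x 1 4"
  "hecke q x (gen1 q x 2 3) = (1 + q\<^sup>2) *s gen1 q x 2 3"
  "hecke q x (gen1 q x 2 4) = (1 + q\<^sup>2) *s gen1 q x 2 4"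
  "hecke q x (gen1 q x 3 4) = (1 + q\<^sup>2) *s gen1 q x 3 4"
  by (simp_all add: coordinates algebra_simps power2_eq_square power3_eq_cube)

lemma hecke_gen2:
  assumes "q \<noteq> 0"
  shows "hecke q x (e 1 \<otimes> e 1) = 0"
  "hecke q x (e 2 \<otimes> e 2) = 0"
  "hecke q x (gen2 q 1 2) = 0"
  "hecke q x (gen2 q 1 3) = 0"
  "hecke q x (gen2 q 1 4) = 0"
  "hecke q x (gen2 q 2 3) = 0"
  "hecke q x (gen2 q 2 4) = 0"
  "hecke q x (gen2 q 3 4) = 0"
  using assms by (simp_all add: coordinates power2_eq_square)

text \<open>
  The next two lemmas decompose \<open>(1 + q\<^sup>2) t\<close> explicitly along the two subspaces. The terms with
  \<open>x\<close> in the last coefficients account for the second summand of \<open>hecke\<close> and, in the first lemma,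
  for the term with \<open>x\<close> in the generator of the pair \<open>(1, 2)\<close>.
\<close>

lemma hecke_expansion:
  "hecke q x t =
     ((1 + q\<^sup>2) * t $ (3, 3)) *s (e 3 \<otimes> e 3) + ((1 + q\<^sup>2) * t $ (4, 4)) *s (e 4 \<otimes> e 4)
     + (t $ (1, 2) - q * t $ (2, 1)) *s gen1 q x 1 2
     + (t $ (1, 3) - q * t $ (3, 1)) *s gen1 q x 1 3
     + (t $ (1, 4) - q * t $ (4, 1)) *s gen1 q x 1 4
     + (t $ (2, 3) - q * t $ (3, 2)) *s gen1 q x 2 3
     + (t $ (2, 4) - q * t $ (4, 2)) *s gen1 q x 2 4
     + (t $ (3, 4) + q * t $ (4, 3) - q * x * (t $ (1, 2) - q * t $ (2, 1))) *s gen1 q x 3 4"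
  by (simp add: coordinates algebra_simps power2_eq_square power3_eq_cube)

lemma hecke_complement_expansion:
  assumes "q \<noteq> 0"
  shows "(1 + q\<^sup>2) *s t - hecke q x t =
     ((1 + q\<^sup>2) * t $ (1, 1)) *s (e 1 \<otimes> e 1) + ((1 + q\<^sup>2) * t $ (2, 2)) *s (e 2 \<otimes> e 2)
     + (q\<^sup>2 * t $ (1, 2) + q * t $ (2, 1)) *s gen2 q 1 2
     + (q\<^sup>2 * t $ (1, 3) + q * t $ (3, 1)) *s gen2 q 1 3
     + (q\<^sup>2 * t $ (1, 4) + q * t $ (4, 1)) *s gen2 q 1 4
     + (q\<^sup>2 * t $ (2, 3) + q * t $ (3, 2)) *s gen2 q 2 3
     + (q\<^sup>2 * t $ (2, 4) + q * t $ (4, 2)) *s gen2 q 2 4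
     + (q\<^sup>2 * t $ (3, 4) - q * t $ (4, 3)
        - x * (q ^ 3 - q) * (t $ (1, 2) - q * t $ (2, 1))) *s gen2 q 3 4"
  using assms by (simp add: coordinates field_simps power2_eq_square power3_eq_cube)

lemma hecke_in_V1: "hecke q x t \<in> V1 q x"
  unfolding hecke_expansion V1_eq
  by (intro vec.span_add vec.span_scale vec.span_base) simp_all

lemma hecke_complement_in_V2:
  assumes "q \<noteq> 0"
  shows "(1 + q\<^sup>2) *s t - hecke q x t \<in> V2 q"
  unfolding hecke_complement_expansion[OF assms] V2_eq
  by (intro vec.span_add vec.span_scale vec.span_base) simp_all

lemma hecke_on_V1:
  assumes "t \<in> V1 q x"
  shows "hecke q x t = (1 + q\<^sup>2) *s t"
proof -
  interpret Vector_Spaces.linear "(*s)" "(*s)" "hecke q x" by (fact linear_hecke)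
  show ?thesis using assms unfolding V1_eq
  proof (induction rule: vec.span_induct_alt)
    case base
    show ?case by (simp add: zero)
  next
    case (step c s t)
    then have "hecke q x s = (1 + q\<^sup>2) *s s"
      by (auto simp: hecke_gen1 simp del: One_nat_def)
    then show ?case
      by (simp only: add scale step.IH) (simp add: vec_eq_iff algebra_simps)
  qed
qed

lemma hecke_on_V2:
  assumes "q \<noteq> 0" and "t \<in> V2 q"
  shows "hecke q x t = 0"
proof -
  interpret Vector_Spaces.linear "(*s)" "(*s)" "hecke q x" by (fact linear_hecke)
  show ?thesis using assms(2) unfolding V2_eq
  proof (induction rule: vec.span_induct_alt)
    case base
    show ?case by (simp add: zero)
  next
    case (step c s t)
    then show ?case
      by (auto simp: add scale hecke_gen2[OF assms(1)] simp del: One_nat_def)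
  qed
qed

text \<open>
  By the last two assumptions every vector is the sum of an element of \<open>U\<close> and one of \<open>W\<close>,
  which makes the projection unique.
\<close>

lemma projection_eqI:
  assumes lin: "Vector_Spaces.linear (*s) (*s) P"
    and U: "\<And>t. t \<in> U \<Longrightarrow> P t = t" and W: "\<And>t. t \<in> W \<Longrightarrow> P t = 0"
    and range: "\<And>t. P t \<in> U" and complement: "\<And>t. t - P t \<in> W"
  shows "projection U W = P"
  unfolding projection_def
proof (rule the_equality)
  fix Q assume Q: "Vector_Spaces.linear (*s) (*s) Q \<and> (\<forall>t\<in>U. Q t = t) \<and> (\<forall>t\<in>W. Q t = 0)"
  interpret Q: Vector_Spaces.linear "(*s)" "(*s)" Q using Q by blast
  show "Q = P"
  proof
    fix t
    have "Q t = Q (P t) + Q (t - P t)" by (simp add: Q.diff)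
    then show "Q t = P t" using Q range complement by simp
  qed
qed (use lin U W in blast)

lemma projections_eq_hecke:
  assumes "q \<noteq> 0" and "1 + q\<^sup>2 \<noteq> 0"
  shows "P1 q x t = inverse (1 + q\<^sup>2) *s hecke q x t"
    and "P2 q x t = t - inverse (1 + q\<^sup>2) *s hecke q x t"
proof -
  interpret Vector_Spaces.linear "(*s)" "(*s)" "hecke q x" by (fact linear_hecke)
  have in_V1: "inverse (1 + q\<^sup>2) *s hecke q x t \<in> V1 q x" for t
    using hecke_in_V1 unfolding V1_def by (rule vec.span_scale)
  have "inverse (1 + q\<^sup>2) *s ((1 + q\<^sup>2) *s t - hecke q x t) \<in> V2 q" for t
    using hecke_complement_in_V2[OF assms(1)] unfolding V2_def by (rule vec.span_scale)
  moreover have "inverse p *s (p *s t - s) = t - inverse p *s s"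
    if "p \<noteq> 0" for p :: complex and s t :: "complex^(4 \<times> 4)"
    using that by (simp add: vec.scale_right_diff_distrib)
  ultimately have in_V2: "t - inverse (1 + q\<^sup>2) *s hecke q x t \<in> V2 q" for t
    using assms(2) by metis
  have on_V1: "inverse (1 + q\<^sup>2) *s hecke q x t = t" if "t \<in> V1 q x" for t
    by (simp only: hecke_on_V1[OF that] vec.scale_scale left_inverse[OF assms(2)] vec.scale_one)
  have on_V2: "inverse (1 + q\<^sup>2) *s hecke q x t = 0" if "t \<in> V2 q" for t
    using hecke_on_V2[OF assms(1) that] by simp
  have "Vector_Spaces.linear (*s) (*s) (\<lambda>t. inverse (1 + q\<^sup>2) *s hecke q x t)"
    by (rule linear_cart) (simp_all add: add scale vec.scale_right_distrib mult.commute)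
  then have "P1 q x = (\<lambda>t. inverse (1 + q\<^sup>2) *s hecke q x t)"
    unfolding P1_def by (rule projection_eqI) (simp_all add: in_V1 in_V2 on_V1 on_V2)
  moreover have "Vector_Spaces.linear (*s) (*s) (\<lambda>t. t - inverse (1 + q\<^sup>2) *s hecke q x t)"
    by (rule linear_cart) (simp_all add: add scale vec.scale_right_distrib
      vec.scale_right_diff_distrib mult.commute)
  then have "P2 q x = (\<lambda>t. t - inverse (1 + q\<^sup>2) *s hecke q x t)"
    unfolding P2_def by (rule projection_eqI) (simp_all add: in_V1 in_V2 on_V1 on_V2)
  ultimately show "P1 q x t = inverse (1 + q\<^sup>2) *s hecke q x t"
    and "P2 q x t = t - inverse (1 + q\<^sup>2) *s hecke q x t"
    by simp_all
qed

lemma R_box_eq_hecke: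
  assumes "q \<noteq> 0" and "1 + q\<^sup>2 \<noteq> 0"
  shows "R_box q u v x t = (q\<^sup>2 * v - u) *s t + (u - v) *s hecke q x t"
proof -
  have "hecke q x t = (1 + q\<^sup>2) *s P1 q x t" and "P2 q x t = t - P1 q x t"
    by (simp_all only: projections_eq_hecke[OF assms] vec.scale_scale right_inverse[OF assms(2)] vec.scale_one)
  then show ?thesis
    by (simp only: R_box_def) (simp add: vec_eq_iff algebra_simps)
qed

section \<open>The cubic relation and its Baxterization\<close>

lemma hecke_braid:
  fixes q x :: complex and t :: "complex^(4 \<times> 4 \<times> 4)"
  defines "A \<equiv> on_12 (hecke q x)" and "B \<equiv> on_23 (hecke q (q * x))"
  shows "A (B (A t)) - q\<^sup>2 *s A t = B (A (B t)) - q\<^sup>2 *s B t"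
  unfolding vec_eq_four_triples forall_4 A_def B_def
  by (intro conjI; simp add: on_12_nth on_23_nth linear_hecke hecke_nth algebra_simps
      power2_eq_square power3_eq_cube)

text \<open>
  With \<open>A (B (A t))\<close> eliminated by the cubic relation and squares by the quadratic relations, both sides
  become combinations of \<open>t\<close>, \<open>A t\<close>, \<open>B t\<close>, \<open>A (B t)\<close>, \<open>B (A t)\<close> and \<open>B (A (B t))\<close>
  with equal coefficients.
\<close>

lemma baxterization:
  fixes A B :: "complex^'n \<Rightarrow> complex^'n"
  assumes A: "Vector_Spaces.linear (*s) (*s) A" and B: "Vector_Spaces.linear (*s) (*s) B"
    and AA: "\<And>t. A (A t) = (1 + p) *s A t" and BB: "\<And>t. B (B t) = (1 + p) *s B t"
    and braid: "\<And>t. A (B (A t)) - p *s A t = B (A (B t)) - p *s B t"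
  defines "R \<equiv> \<lambda>C u v t. (p * v - u) *s t + (u - v) *s C t"
  shows "R A v w (R B u w (R A u v t)) = R B u v (R A u w (R B v w t))"
proof -
  interpret A: Vector_Spaces.linear "(*s)" "(*s)" A by (fact A)
  interpret B: Vector_Spaces.linear "(*s)" "(*s)" B by (fact B)
  have ABA: "A (B (A t)) = B (A (B t)) - p *s B t + p *s A t" for t
    using braid[of t] by (simp add: algebra_simps)
  show ?thesis
    unfolding R_def
    by (simp add: A.add A.diff A.scale B.add B.diff B.scale AA BB ABA vec.scale_left_diff_distrib)
      (simp add: vec_eq_iff algebra_simps)
qed

theorem theorem1:
  fixes q x u v w :: complex
  assumes "q \<noteq> 0"
    and "\<And>r::nat. r > 0 \<Longrightarrow> q ^ r \<noteq> 1"
  shows "on_12 (R_box q v w x) \<circ> on_23 (R_box q u w (q * x)) \<circ> on_12 (R_box q u v x)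
       = on_23 (R_box q u v (q * x)) \<circ> on_12 (R_box q u w x) \<circ> on_23 (R_box q v w (q * x))"
proof -
  have q2: "1 + q\<^sup>2 \<noteq> 0"
  proof
    assume "1 + q\<^sup>2 = 0"
    then have "q\<^sup>2 = - 1" by (simp add: add_eq_0_iff)
    then have "(q\<^sup>2)\<^sup>2 = 1" by simp
    then have "q ^ 4 = 1" by (simp flip: power_mult)
    then show False using assms(2)[of 4] by simp
  qed
  define A where "A = on_12 (hecke q x)"
  define B where "B = on_23 (hecke q (q * x))"
  have lin: "Vector_Spaces.linear (*s) (*s) (R_box q u v x)" for u v x
    by (rule linear_cart)
      (simp_all add: R_box_eq_hecke[OF assms(1) q2] vec_eq_four_pairs forall_4 hecke_nth algebra_simps)
  have R12: "on_12 (R_box q u v x) t = (q\<^sup>2 * v - u) *s t + (u - v) *s A t" for u v t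
    by (simp add: A_def vec_eq_iff on_12_nth lin linear_hecke R_box_eq_hecke[OF assms(1) q2])
  have R23: "on_23 (R_box q u v (q * x)) t = (q\<^sup>2 * v - u) *s t + (u - v) *s B t" for u v t
    by (simp add: B_def vec_eq_iff on_23_nth lin linear_hecke R_box_eq_hecke[OF assms(1) q2])
  have "A (A t) = (1 + q\<^sup>2) *s A t" for t
    by (simp add: A_def vec_eq_iff on_12_nth linear_hecke hecke_hecke)
  moreover have "B (B t) = (1 + q\<^sup>2) *s B t" for t
    by (simp add: B_def vec_eq_iff on_23_nth on_23_slice linear_hecke hecke_hecke)
  moreover have "A (B (A t)) - q\<^sup>2 *s A t = B (A (B t)) - q\<^sup>2 *s B t" for t
    unfolding A_def B_def by (rule hecke_braid)
  ultimately show ?thesis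
    using baxterization[of A B "q\<^sup>2"]
    by (simp add: fun_eq_iff R12 R23 linear_on_12 linear_on_23 linear_hecke A_def B_def)
qed

end
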